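(* Let $0<\varphi<\frac{\pi}{2}$, $c=\cos\varphi$, $s=\sin\varphi=\sqrt{1-c^2}$, and consider quartic $G^2$ approximants, with parameter $\xi>0$, of the circular arc $\alpha\mapsto(\cos\alpha,\sin\alpha)^T$, $\alpha\in[-\varphi,\varphi]$. Let $$\mathrm{td}(\xi)=\frac{48\sqrt{1-c^2}}{c}\,\xi^3+48\xi^2-12\sqrt{1-c^2}\left(\frac3c+c\right)\xi+12(1-c^2),\qquad \delta_2=\frac{-2c+\sqrt{9-2c^2-3c^4}}{6\sqrt{1-c^2}}.$$ Then $\mathrm{td}$ has exactly one zero $\xi^\land$ on $[\delta_2,\infty)$, and the optimal outer approximant is induced by $\xi^\land$. Moreover, in the limit $c\to0$, $\xi^\land\to\frac{\sqrt3}{2}$ and the abscissa of the control point $b_2$ satisfies $\frac{3-4(\xi^\land)^2}{3c}\to\frac{8\sqrt3}{9}$.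
   Context: For $c>0$ and real $\xi>0$, the quartic $G^2$ approximant with parameter $\xi$ is the curve $p:[-1,1]\to\mathbb{R}^2$, $p(t)=\sum_{i=0}^4\binom{4}{i}\left(\frac{1+t}{2}\right)^i\left(\frac{1-t}{2}\right)^{4-i}b_i$, with control points $b_0=(c,-s)^T$, $b_1=(c,-s)^T+\xi(s,c)^T$, $b_2=\left(\frac{3-4\xi^2}{3c},0\right)^T$, $b_3=(c,s)^T+\xi(s,-c)^T$, $b_4=(c,s)^T$. Its simplified radial error function is $\psi(t,\xi)=\|p(t)\|_2^2-1$. (The function $\mathrm{td}(\xi)$ is the third derivative of $\psi(\cdot,\xi)$ with respect to $t$ at $t=1$.) The approximant is outer if $\psi(t,\xi)\ge0$ for all $t\in[-1,1]$. An outer approximant is optimal if it minimizes $\max_{t\in[-1,1]}|\psi(t,\xi)|$ among all outer approximants of this form. *)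

theory Defs
  imports "HOL-Analysis.Analysis"
begin

text \<open>Throughout, \<open>c\<close> and \<open>s\<close> stand for the cosine and sine of the half-angle of the arc.\<close>

definition control_points :: "real \<Rightarrow> real \<Rightarrow> real \<Rightarrow> (real^2) list" where
  "control_points c s \<xi> =
     [vector [c, -s],
      vector [c, -s] + \<xi> *\<^sub>R vector [s, c],
      vector [(3 - 4 * \<xi>\<^sup>2) / (3 * c), 0],
      vector [c, s] + \<xi> *\<^sub>R vector [s, -c],
      vector [c, s]]"

definition approximant :: "real \<Rightarrow> real \<Rightarrow> real \<Rightarrow> real \<Rightarrow> real^2" where
  "approximant c s \<xi> t =
     (\<Sum>i\<le>4. (real (4 choose i) * ((1 + t) / 2) ^ i * ((1 - t) / 2) ^ (4 - i))
               *\<^sub>R (control_points c s \<xi> ! i))"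

definition radial_error :: "real \<Rightarrow> real \<Rightarrow> real \<Rightarrow> real \<Rightarrow> real" where
  "radial_error c s t \<xi> = (norm (approximant c s \<xi> t))\<^sup>2 - 1"

definition outer :: "real \<Rightarrow> real \<Rightarrow> real \<Rightarrow> bool" where
  "outer c s \<xi> \<longleftrightarrow> (\<forall>t\<in>{-1..1}. radial_error c s t \<xi> \<ge> 0)"

text \<open>The supremum is a maximum, since the radial error is continuous in \<open>t\<close>.\<close>

definition max_error :: "real \<Rightarrow> real \<Rightarrow> real \<Rightarrow> real" where
  "max_error c s \<xi> = (SUP t\<in>{-1..1}. \<bar>radial_error c s t \<xi>\<bar>)"

definition optimal_outer :: "real \<Rightarrow> real \<Rightarrow> real \<Rightarrow> bool" where
  "optimal_outer c s \<xi> \<longleftrightarrow>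
     \<xi> > 0 \<and> outer c s \<xi> \<and>
     (\<forall>\<eta>>0. outer c s \<eta> \<longrightarrow> max_error c s \<xi> \<le> max_error c s \<eta>)"

definition td :: "real \<Rightarrow> real \<Rightarrow> real" where
  "td c \<xi> = 48 * sqrt (1 - c\<^sup>2) / c * \<xi> ^ 3 + 48 * \<xi>\<^sup>2
     - 12 * sqrt (1 - c\<^sup>2) * (3 / c + c) * \<xi> + 12 * (1 - c\<^sup>2)"

definition delta2 :: "real \<Rightarrow> real" where
  "delta2 c = (- 2 * c + sqrt (9 - 2 * c\<^sup>2 - 3 * c ^ 4)) / (6 * sqrt (1 - c\<^sup>2))"

text \<open>Meaningful only where the zero exists and is unique.\<close>

definition xi_hat :: "real \<Rightarrow> real" where
  "xi_hat c = (THE \<xi>. \<xi> \<in> {delta2 c..} \<and> td c \<xi> = 0)"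

end

theory Submission
  imports Defs
begin

text \<open>
  With \<open>u = 1 - t\<^sup>2\<close> the radial error is \<open>u\<^sup>3 (A + B u)\<close>, where \<open>A = - td \<xi> / 48\<close> and \<open>B\<close> is a
  square. An outer approximant therefore has \<open>td \<xi> \<le> 0\<close>, hence \<open>\<xi> \<le> \<xi>\<^sup>\<and>\<close>, and at \<open>\<xi>\<^sup>\<and>\<close> the error is
  \<open>B u\<^sup>4 \<ge> 0\<close>, largest at \<open>t = 0\<close>. For the other outer parameters the error at \<open>t = 0\<close> is already
  strictly larger: \<open>p(0)\<close> has vanishing ordinate, and its abscissa is a concave quadratic in \<open>\<xi>\<close>
  that takes equal values at \<open>\<xi>\<close> and \<open>\<xi>'\<close> precisely if \<open>\<xi> + \<xi>' = s c\<close>, whereas \<open>\<xi> + \<xi>\<^sup>\<and> > s c\<close>: the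
  roots of \<open>td\<close> add up to \<open>- c / s\<close>, and \<open>td (- c / s - s c) > 0\<close>.
\<close>

text \<open>The sine is a separate parameter, so that the same lemmas serve the pair
  \<open>cos\<close>, \<open>sin\<close> of the final theorem and the pair \<open>c\<close>,
  \<open>sqrt (1 - c\<^sup>2)\<close> of the limits.\<close>

locale arc =
  fixes c s :: real
  assumes c_pos: "0 < c" and s_pos: "0 < s" and s2: "s\<^sup>2 = 1 - c\<^sup>2"
begin

lemma c_less_1: "c < 1"
proof -
  have "c\<^sup>2 < 1" using s_pos s2 by (smt (verit) zero_less_power)
  then show ?thesis by (simp add: power2_less_1_iff abs_square_less_1)
qed

lemma s_eq: "sqrt (1 - c\<^sup>2) = s"
  using s_pos s2 by (metis less_imp_le real_sqrt_unique)

section \<open>The numerator of \<open>td\<close> and its zero\<close>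

definition cubic :: "real \<Rightarrow> real" where
  "cubic x = 4 * s * x ^ 3 + 4 * c * x\<^sup>2 - s * (3 + c\<^sup>2) * x + c * s\<^sup>2"

lemma td_eq: "td c x = 12 / c * cubic x"
  using c_pos unfolding td_def cubic_def s_eq unfolding s2[symmetric]
  by (simp add: field_simps power2_eq_square)

lemma td_signs:
  "td c x = 0 \<longleftrightarrow> cubic x = 0" "td c x \<le> 0 \<longleftrightarrow> cubic x \<le> 0"
  using c_pos by (auto simp: td_eq mult_le_0_iff divide_le_0_iff)

abbreviation d :: real where "d \<equiv> delta2 c"

text \<open>The derivative of \<open>cubic\<close> is \<open>12 s x^2 + 8 c x - s (3 + c^2)\<close>,
  and \<open>d\<close> is its positive root: the local minimum of \<open>cubic\<close>.\<close>

lemma delta2_pos: "0 < d" and delta2_critical: "12 * s * d\<^sup>2 + 8 * c * d = s * (3 + c\<^sup>2)"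
proof -
  define r where "r = sqrt (9 - 2 * c\<^sup>2 - 3 * c ^ 4)"
  have c2: "c\<^sup>2 < 1" using c_less_1 c_pos by (simp add: power_less_one_iff)
  have c4: "c ^ 4 < 1" using c_less_1 c_pos by (simp add: power_less_one_iff)
  have r2: "r\<^sup>2 = 9 - 2 * c\<^sup>2 - 3 * c ^ 4" unfolding r_def using c2 c4 by simp
  have "0 \<le> r" unfolding r_def using c2 c4 by simp
  have "(2 * c)\<^sup>2 < r\<^sup>2" using r2 c2 c4 by (simp add: power_mult_distrib)
  then have "2 * c < r" using \<open>0 \<le> r\<close> by (rule power2_less_imp_less)
  moreover have d: "d = (r - 2 * c) / (6 * s)" unfolding delta2_def s_eq r_def by simp
  ultimately show "0 < d" using s_pos by simp
  have rd: "r = 6 * s * d + 2 * c" using d s_pos by (simp add: field_simps)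
  have "3 * s * (12 * s * d\<^sup>2 + 8 * c * d) = r\<^sup>2 - 4 * c\<^sup>2"
    unfolding rd by algebra
  also have "\<dots> = 3 * s * (s * (3 + c\<^sup>2))"
    using r2 s2 by algebra
  finally show "12 * s * d\<^sup>2 + 8 * c * d = s * (3 + c\<^sup>2)"
    using s_pos by simp
qed

text \<open>Taylor expansion about the critical point \<open>d\<close>: the linear term drops out,
  and what remains visibly grows to the right of \<open>d\<close>.\<close>

lemma cubic_expand: "cubic x = cubic d + 4 * (x - d)\<^sup>2 * (s * (x + 2 * d) + c)"
  using delta2_critical unfolding cubic_def by algebra

lemma cubic_strict_mono:
  assumes "d \<le> x" "x < y" shows "cubic x < cubic y"
proof -
  have "(x - d)\<^sup>2 * (s * (x + 2 * d) + c) < (y - d)\<^sup>2 * (s * (y + 2 * d) + c)"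
    using assms c_pos s_pos delta2_pos
    by (intro mult_strict_mono power_strict_mono add_strict_right_mono mult_strict_left_mono)
       (auto intro!: add_nonneg_nonneg)
  then show ?thesis unfolding cubic_expand[of x] cubic_expand[of y] by simp
qed

text \<open>The test point \<open>s / 2\<close> separates \<open>d\<close> from the zero. It also
  supplies the lower bound on \<open>h\<close> that the limit needs.\<close>

lemma cubic_half_neg: "cubic (s / 2) < 0"
proof -
  have "cubic (s / 2) = - (s\<^sup>2 * (1 - c)\<^sup>2)"
  proof -
    have "2 * cubic (s / 2) = s\<^sup>2 * (s\<^sup>2 + 4 * c - 3 - c\<^sup>2)"
      unfolding cubic_def by (simp add: field_simps power2_eq_square power3_eq_cube)
    then show ?thesis unfolding s2 by (simp add: algebra_simps power2_eq_square)
  qed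
  then show ?thesis using s_pos c_less_1 by simp
qed

lemma delta2_less_half: "d < s / 2"
proof (rule ccontr)
  assume "\<not> d < s / 2"
  then have *: "s / 2 \<le> d" by simp
  \<comment> \<open>The derivative of \<open>cubic\<close> increases on the positive axis and
    vanishes at \<open>d\<close>, yet it is already positive at \<open>s / 2\<close>.\<close>
  have "12 * s * (s / 2)\<^sup>2 + 8 * c * (s / 2) \<le> 12 * s * d\<^sup>2 + 8 * c * d"
    using * s_pos c_pos by (intro add_mono mult_left_mono power_mono) auto
  moreover have "12 * s * (s / 2)\<^sup>2 + 8 * c * (s / 2) - s * (3 + c\<^sup>2) = s * (4 * c * (1 - c))"
    using s2 by (simp add: field_simps) algebra
  moreover have "0 < s * (4 * c * (1 - c))" using s_pos c_pos c_less_1 by simp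
  ultimately show False using delta2_critical by simp
qed

lemma s_less_1: "s < 1"
  using s2 c_pos s_pos by (smt (verit) one_le_power zero_less_power)

lemma half_less_sqrt3: "s / 2 < sqrt 3 / 2"
  using s_less_1 by (smt (verit) divide_strict_right_mono real_sqrt_ge_1_iff)

text \<open>At \<open>sqrt 3 / 2\<close> the terms \<open>4 s x^3\<close> and \<open>- 3 s x\<close>
  cancel, which leaves a multiple of \<open>c\<close>.\<close>

lemma cubic_sqrt3_pos: "0 < cubic (sqrt 3 / 2)"
proof -
  have "cubic (sqrt 3 / 2) = c * (3 - s * c * (sqrt 3 / 2) + s\<^sup>2)"
    unfolding cubic_def by (simp add: power3_eq_cube power2_eq_square algebra_simps)
  moreover have "s * c * (sqrt 3 / 2) < 1"
  proof -
    have "s * c < 1 * 1" using s_less_1 c_less_1 s_pos c_pos by (intro mult_strict_mono) auto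
    moreover have "sqrt 3 / 2 < 1" by (simp add: real_less_lsqrt)
    ultimately have "s * c * (sqrt 3 / 2) < 1 * 1"
      using s_pos c_pos by (intro mult_strict_mono) auto
    then show ?thesis by simp
  qed
  ultimately show ?thesis using c_pos by (smt (verit) mult_pos_pos zero_le_power2)
qed

lemma ex1_zero: "\<exists>!x. x \<in> {d..} \<and> td c x = 0"
proof -
  have "continuous_on {s / 2..sqrt 3 / 2} cubic" unfolding cubic_def by (intro continuous_intros)
  then obtain h where "s / 2 \<le> h" "cubic h = 0"
    using IVT'[of cubic "s / 2" 0 "sqrt 3 / 2"] cubic_half_neg cubic_sqrt3_pos half_less_sqrt3
    by auto
  moreover have "x = y" if "d \<le> x" "d \<le> y" "cubic x = 0" "cubic y = 0" for x y
    using that cubic_strict_mono by (metis less_irrefl linorder_neqE)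
  ultimately show ?thesis using delta2_less_half by (auto simp: td_signs intro!: ex1I[of _ h])
qed

abbreviation h :: real where "h \<equiv> xi_hat c"

lemma xi_hat: "d \<le> h" "cubic h = 0"
  using theI'[OF ex1_zero] unfolding xi_hat_def[symmetric] by (auto simp: td_signs)

lemma xi_hat_greater: "s / 2 < h"
  using cubic_half_neg cubic_strict_mono[of h "s / 2"] xi_hat
  by (metis less_irrefl linorder_neqE order.asym)

lemma xi_hat_less: "h < sqrt 3 / 2"
  using cubic_sqrt3_pos cubic_strict_mono[of "sqrt 3 / 2" h] xi_hat delta2_less_half half_less_sqrt3
  by (metis less_imp_le less_irrefl linorder_neqE order.asym order.strict_trans)

lemma xi_hat_pos: "0 < h"
  using xi_hat_greater s_pos by simp

lemma xi_hat_sq_less: "h\<^sup>2 < 3 / 4"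
  using power_strict_mono[OF xi_hat_less, of 2] xi_hat_pos by (simp add: power_divide)

section \<open>The radial error as a polynomial in \<open>1 - t\<^sup>2\<close>\<close>

text \<open>The coefficient of \<open>u\<^sup>4\<close> in the radial error, where \<open>u = 1 - t\<^sup>2\<close>.\<close>

definition lead :: "real \<Rightarrow> real" where
  "lead x = (3 * ((3 - 4 * x\<^sup>2) / (3 * c) - c) / 8 - x * s / 2)\<^sup>2"

lemma lead_nonneg: "0 \<le> lead x"
  by (simp add: lead_def)

text \<open>The control points are symmetric about the first axis, so the abscissa is even in
  \<open>t\<close> and the ordinate is \<open>t\<close> times an even polynomial.\<close>

lemma approximant_components:
  "approximant c s x t $ 1 = c + x * s * (1 - t\<^sup>2) * (1 + t\<^sup>2) / 2
     + 3 * ((3 - 4 * x\<^sup>2) / (3 * c) - c) * (1 - t\<^sup>2)\<^sup>2 / 8"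
  "approximant c s x t $ 2 = t * (s + (s / 2 - x * c) * (1 - t\<^sup>2))"
proof -
  define b where "b = (3 - 4 * x\<^sup>2) / (3 * c)"
  have sum4: "(\<Sum>i\<le>4. f i) = f 0 + f 1 + f 2 + f 3 + f 4" for f :: "nat \<Rightarrow> real^2"
    by (simp add: numeral_eq_Suc)
  have ch: "(4::nat) choose 2 = 6" "(4::nat) choose 3 = 4"
    by (simp_all add: numeral_eq_Suc)
  have p: "approximant c s x t =
      ((1 - t) / 2) ^ 4 *\<^sub>R vector [c, -s]
    + (4 * ((1 + t) / 2) * ((1 - t) / 2) ^ 3) *\<^sub>R (vector [c, -s] + x *\<^sub>R vector [s, c])
    + (6 * ((1 + t) / 2)\<^sup>2 * ((1 - t) / 2)\<^sup>2) *\<^sub>R vector [b, 0]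
    + (4 * ((1 + t) / 2) ^ 3 * ((1 - t) / 2)) *\<^sub>R (vector [c, s] + x *\<^sub>R vector [s, -c])
    + ((1 + t) / 2) ^ 4 *\<^sub>R vector [c, s]"
    unfolding approximant_def control_points_def b_def[symmetric] sum4 by (simp add: ch)
  show "approximant c s x t $ 1 = c + x * s * (1 - t\<^sup>2) * (1 + t\<^sup>2) / 2
     + 3 * ((3 - 4 * x\<^sup>2) / (3 * c) - c) * (1 - t\<^sup>2)\<^sup>2 / 8"
    unfolding p b_def[symmetric] by (simp add: vector_2 field_simps) algebra
  show "approximant c s x t $ 2 = t * (s + (s / 2 - x * c) * (1 - t\<^sup>2))"
    unfolding p by (simp add: vector_2 field_simps) algebra
qed

lemma radial_error_components:
  "radial_error c s t x = (approximant c s x t $ 1)\<^sup>2 + (approximant c s x t $ 2)\<^sup>2 - 1"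
  by (simp add: radial_error_def norm_vec_def L2_set_def sum_2)

text \<open>The G^2 contact at both ends removes the terms in \<open>u\<close> and
  \<open>u^2\<close>; the abscissa of the middle control point enters only the second
  cancellation.\<close>

lemma radial_error_eq:
  "radial_error c s t x = (1 - t\<^sup>2) ^ 3 * (lead x * (1 - t\<^sup>2) - cubic x / (4 * c))"
proof -
  define u where "u = 1 - t\<^sup>2"
  define b where "b = (3 - 4 * x\<^sup>2) / (3 * c)"
  \<comment> \<open>The abscissa becomes \<open>c + f u (2 - u) + e u^2\<close> and the ordinate
    \<open>t (s + g u)\<close>. Facts 1 and 2 below are the vanishing coefficients of
    \<open>u\<close> and \<open>u^2\<close>; fact 3 is the negated coefficient of
    \<open>u^3\<close>.\<close>
  define e where "e = 3 * (b - c) / 8"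
  define f where "f = x * s / 2"
  define g where "g = s / 2 - x * c"
  have b: "3 * c * b = 3 - 4 * x\<^sup>2" using c_pos by (simp add: b_def)
  have 1: "4 * c * f + 2 * s * g - s\<^sup>2 = 0"
    unfolding f_def g_def by (simp add: algebra_simps power2_eq_square)
  have "4 * (4 * f\<^sup>2 + 2 * c * (e - f) + g\<^sup>2 - 2 * s * g)
      = 4 * x\<^sup>2 * (s\<^sup>2 + c\<^sup>2) + 3 * c * b - 3 * (s\<^sup>2 + c\<^sup>2)"
    unfolding e_def f_def g_def by (simp add: field_simps power2_eq_square)
  then have 2: "4 * f\<^sup>2 + 2 * c * (e - f) + g\<^sup>2 - 2 * s * g = 0"
    using b s2 by simp
  have "4 * c * (g\<^sup>2 - 4 * f * (e - f))
      = c * s\<^sup>2 - s * x * (3 * c * b + c\<^sup>2) + 4 * c * x\<^sup>2 * (s\<^sup>2 + c\<^sup>2)"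
    unfolding e_def f_def g_def by (simp add: field_simps power2_eq_square)
  also have "\<dots> = cubic x"
    unfolding b cubic_def s2 by (simp add: algebra_simps power2_eq_square power3_eq_cube)
  finally have 3: "g\<^sup>2 - 4 * f * (e - f) = cubic x / (4 * c)"
    using c_pos by (simp add: field_simps)
  have t2: "t\<^sup>2 = 1 - u" by (simp add: u_def)
  have "radial_error c s t x
      = (c + f * u * (2 - u) + e * u\<^sup>2)\<^sup>2 + (1 - u) * (s + g * u)\<^sup>2 - 1"
    unfolding radial_error_components approximant_components
      b_def[symmetric] power_mult_distrib t2 e_def f_def g_def by (simp add: field_simps)
  also have "\<dots> = (c\<^sup>2 + s\<^sup>2 - 1) + u * (4 * c * f + 2 * s * g - s\<^sup>2)
      + u\<^sup>2 * (4 * f\<^sup>2 + 2 * c * (e - f) + g\<^sup>2 - 2 * s * g)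
      + u ^ 3 * ((e - f)\<^sup>2 * u - (g\<^sup>2 - 4 * f * (e - f)))"
    by algebra
  also have "\<dots> = u ^ 3 * (lead x * u - cubic x / (4 * c))"
    using s2 unfolding 1 2 3 by (simp add: lead_def e_def f_def b_def)
  finally show ?thesis unfolding u_def .
qed

section \<open>Outer parameters and their maximal error\<close>

lemma outer_xi_hat: "outer c s h"
  unfolding outer_def using lead_nonneg xi_hat
  by (auto simp: radial_error_eq abs_square_le_1 intro!: mult_nonneg_nonneg zero_le_power)

text \<open>Near the ends of the arc \<open>u\<close> is small, and the error has the sign of
  \<open>- cubic x\<close> unless that vanishes.\<close>

lemma outer_imp_le:
  assumes "outer c s x" shows "x \<le> h" "cubic x \<le> 0"
proof -
  show "cubic x \<le> 0"
  proof (rule ccontr)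
    assume "\<not> cubic x \<le> 0"
    define k where "k = cubic x / (4 * c)"
    have k: "0 < k" using \<open>\<not> cubic x \<le> 0\<close> c_pos by (simp add: k_def)
    \<comment> \<open>Small enough for \<open>lead x * u < k\<close>, below 1, and meaningful even
      if \<open>lead x = 0\<close>.\<close>
    define u where "u = k / (k + lead x + 1)"
    have pos: "0 < k + lead x + 1" using k lead_nonneg[of x] by linarith
    have u: "0 < u" "u < 1" using k lead_nonneg[of x] pos unfolding u_def by auto
    have "k * lead x < k * (k + lead x + 1)" using k by simp
    then have "lead x * u < k" using pos unfolding u_def
      by (simp add: pos_divide_less_eq mult.commute)
    then have "u ^ 3 * (lead x * u - k) < 0" using u by (simp add: mult_pos_neg)
    moreover have "sqrt (1 - u) \<in> {-1..1}"
      using u by (auto intro: order_trans[of _ 0])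
    then have "0 \<le> radial_error c s (sqrt (1 - u)) x"
      using assms unfolding outer_def by blast
    ultimately show False using u by (simp add: radial_error_eq k_def)
  qed
  then show "x \<le> h"
    using cubic_strict_mono[of h x] xi_hat by force
qed

text \<open>Crude in general, but sharp at \<open>h\<close>: there the cubic term vanishes and the
  bound is the error at \<open>t = 0\<close>. For other parameters it makes the supremum well
  behaved.\<close>

lemma abs_radial_error_le:
  assumes "t \<in> {-1..1}"
  shows "\<bar>radial_error c s t x\<bar> \<le> lead x + \<bar>cubic x / (4 * c)\<bar>"
proof -
  define u where "u = 1 - t\<^sup>2"
  have u: "0 \<le> u" "u \<le> 1" using assms by (auto simp: u_def abs_square_le_1)
  have "\<bar>radial_error c s t x\<bar> = u ^ 3 * \<bar>lead x * u - cubic x / (4 * c)\<bar>"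
    using u by (simp add: radial_error_eq u_def[symmetric] abs_mult)
  also have "\<dots> \<le> 1 * \<bar>lead x * u - cubic x / (4 * c)\<bar>"
    using u by (intro mult_right_mono power_le_one) auto
  also have "\<dots> \<le> lead x * u + \<bar>cubic x / (4 * c)\<bar>"
    using u lead_nonneg[of x] abs_triangle_ineq4[of "lead x * u" "cubic x / (4 * c)"]
    by (simp add: abs_mult)
  also have "\<dots> \<le> lead x + \<bar>cubic x / (4 * c)\<bar>"
    using u lead_nonneg[of x] by (simp add: mult_left_le)
  finally show ?thesis .
qed

lemma max_error_ge: "radial_error c s 0 x \<le> max_error c s x"
proof -
  have "bdd_above ((\<lambda>t. \<bar>radial_error c s t x\<bar>) ` {-1..1})"
    using abs_radial_error_le by (intro bdd_aboveI2)
  then have "\<bar>radial_error c s 0 x\<bar> \<le> max_error c s x"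
    unfolding max_error_def by (intro cSUP_upper) auto
  then show ?thesis by simp
qed

lemma max_error_xi_hat_le: "max_error c s h \<le> radial_error c s 0 h"
  unfolding max_error_def
proof (rule cSUP_least)
  fix t :: real assume "t \<in> {-1..1}"
  from abs_radial_error_le[OF this, of h]
  show "\<bar>radial_error c s t h\<bar> \<le> radial_error c s 0 h"
    using xi_hat by (simp add: radial_error_eq)
qed auto

section \<open>Comparison of the errors at \<open>t = 0\<close>\<close>

text \<open>
  Dividing \<open>cubic\<close> by \<open>x - h\<close> leaves the quadratic \<open>q\<close>; its axis of symmetry exchanges
  \<open>- c / s - s c\<close> and \<open>s c - h\<close>.
\<close>

lemma sum_greater:
  assumes x: "0 < x" "x < h" and le: "cubic x \<le> 0"
  shows "s * c < x + h"
proof (rule ccontr)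
  assume "\<not> s * c < x + h"
  define m where "m = s * c - h"
  define z where "z = c / s + s * c"
  define q where "q y = 4 * s * (y\<^sup>2 + y * h + h\<^sup>2) + 4 * c * (y + h) - s * (3 + c\<^sup>2)" for y
  have fac: "cubic y = (y - h) * q y" for y
    using xi_hat(2) unfolding q_def cubic_def by algebra
  have sz: "s * z = c + s\<^sup>2 * c"
    using s_pos by (simp add: z_def field_simps power2_eq_square)
  have "x \<le> m" using \<open>\<not> s * c < x + h\<close> by (simp add: m_def)
  have "0 \<le> q x" using le x unfolding fac[of x] by (simp add: mult_le_0_iff)
  also have "q x \<le> q m" unfolding q_def
    using \<open>x \<le> m\<close> x xi_hat_pos s_pos c_pos
    by (intro diff_right_mono add_mono mult_left_mono mult_right_mono power_mono) auto
  also have "q m = q (- z)"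
  proof -
    have "s * (q m - q (- z)) = 0" unfolding q_def m_def using sz by algebra
    then show ?thesis using s_pos by simp
  qed
  finally have "0 \<le> (z + h) * q (- z)"
    using xi_hat_pos s_pos c_pos by (intro mult_nonneg_nonneg) (auto simp: z_def)
  then have "cubic (- z) \<le> 0" unfolding fac[of "- z"] by (simp add: algebra_simps)
  \<comment> \<open>The point \<open>- z\<close> no longer involves \<open>h\<close>, so the value
    there is explicit. The factor \<open>s\<^sup>2\<close> clears the denominators of
    \<open>z\<close>.\<close>
  moreover have "s\<^sup>2 * cubic (- z) = s\<^sup>2 * (c * (3 * s ^ 4 + 4 * s ^ 6))"
    unfolding cubic_def using sz s2 by algebra
  then have "cubic (- z) = c * (3 * s ^ 4 + 4 * s ^ 6)" using s_pos by simp
  ultimately show False using c_pos s_pos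
    by (smt (verit) mult_pos_pos zero_less_power)
qed

lemma radial_error_0:
  "radial_error c s 0 x = ((5 * c\<^sup>2 + 3 + 4 * s * c * x - 4 * x\<^sup>2) / (8 * c))\<^sup>2 - 1"
proof -
  have "approximant c s x 0 $ 1 = (5 * c\<^sup>2 + 3 + 4 * s * c * x - 4 * x\<^sup>2) / (8 * c)"
    using c_pos unfolding approximant_components by (simp add: field_simps power2_eq_square)
  moreover have "approximant c s x 0 $ 2 = 0"
    unfolding approximant_components by simp
  ultimately show ?thesis unfolding radial_error_components by simp
qed

lemma radial_error_0_less:
  assumes x: "0 < x" "x < h" and le: "cubic x \<le> 0"
  shows "radial_error c s 0 h < radial_error c s 0 x"
proof -
  let ?p = "\<lambda>x. 5 * c\<^sup>2 + 3 + 4 * s * c * x - 4 * x\<^sup>2"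
  have "?p x - ?p h = 4 * (h - x) * (x + h - s * c)" by algebra
  moreover have "0 < 4 * (h - x) * (x + h - s * c)" using sum_greater[OF assms] x by simp
  ultimately have "?p h < ?p x" by linarith
  \<comment> \<open>Squaring preserves the order only for nonnegative abscissas.\<close>
  moreover have "0 \<le> ?p h"
  proof -
    have "0 \<le> 4 * s * c * h" using s_pos c_pos xi_hat_pos by simp
    then show ?thesis using xi_hat_sq_less zero_le_power2[of c] by linarith
  qed
  ultimately have "(?p h / (8 * c))\<^sup>2 < (?p x / (8 * c))\<^sup>2"
    using c_pos by (intro power_strict_mono divide_strict_right_mono) auto
  then show ?thesis unfolding radial_error_0 by simp
qed

text \<open>The strict comparison at \<open>t = 0\<close> carries over to the maximal errors, hence
  uniqueness of the optimum.\<close>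

lemma optimal_outer_iff: "optimal_outer c s x \<longleftrightarrow> x = h"
proof -
  have less: "max_error c s h < max_error c s y" if "0 < y" "outer c s y" "y \<noteq> h" for y
    using radial_error_0_less[of y] outer_imp_le[of y] that max_error_ge[of y] max_error_xi_hat_le
    by force
  show ?thesis
  proof
    assume "optimal_outer c s x"
    then show "x = h"
      unfolding optimal_outer_def using less[of x] xi_hat_pos outer_xi_hat by force
  next
    assume "x = h"
    then show "optimal_outer c s x"
      unfolding optimal_outer_def using less xi_hat_pos outer_xi_hat by force
  qed
qed

section \<open>The limit \<open>c\<close> to 0\<close>

text \<open>This is \<open>cubic h = 0\<close> solved for \<open>3 - 4 * h\<^sup>2\<close>. The
  explicit factor \<open>c\<close> cancels the one in the denominator of the middle
  abscissa.\<close>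

lemma defect_eq: "3 - 4 * h\<^sup>2 = c * ((4 * h\<^sup>2 - s * c * h + s\<^sup>2) / (s * h))"
proof -
  have "s * h * (3 - 4 * h\<^sup>2) = c * (4 * h\<^sup>2 - s * c * h + s\<^sup>2)"
    using xi_hat(2) unfolding cubic_def by algebra
  then show ?thesis using s_pos xi_hat_pos by (simp add: field_simps)
qed

text \<open>The cofactor of \<open>c\<close> stays bounded, since its numerator is at most 4 and
  \<open>h\<close> exceeds \<open>s / 2\<close>; this squeezes \<open>h\<^sup>2\<close> to
  3/4.\<close>

lemma defect_le: "3 - 4 * h\<^sup>2 \<le> 8 * c / (1 - c\<^sup>2)"
proof -
  have "0 \<le> s * c * h" using s_pos c_pos xi_hat_pos by simp
  moreover have "s\<^sup>2 \<le> 1" using s2 by simp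
  ultimately have "4 * h\<^sup>2 - s * c * h + s\<^sup>2 \<le> 4" using xi_hat_sq_less by linarith
  moreover have "s\<^sup>2 / 2 \<le> s * h" using xi_hat_greater s_pos by (simp add: power2_eq_square)
  ultimately have "(4 * h\<^sup>2 - s * c * h + s\<^sup>2) / (s * h) \<le> 4 / (s\<^sup>2 / 2)"
    using s_pos xi_hat_pos by (intro frac_le) auto
  then have "c * ((4 * h\<^sup>2 - s * c * h + s\<^sup>2) / (s * h)) \<le> c * (4 / (s\<^sup>2 / 2))"
    using c_pos by (intro mult_left_mono) auto
  then show ?thesis unfolding defect_eq s2 by (simp add: mult.commute)
qed

end

lemma arc_sqrt: "0 < c \<Longrightarrow> c < 1 \<Longrightarrow> arc c (sqrt (1 - c\<^sup>2))"
  by unfold_locales (auto simp: power_less_one_iff abs_square_le_1 abs_square_less_1)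

lemma eventually_arc: "eventually (\<lambda>c. arc c (sqrt (1 - c\<^sup>2))) (at_right 0)"
  using eventually_at_right_less[of 0] eventually_at_right_field[of "\<lambda>c. c < 1" "0::real"]
  by (auto intro: arc_sqrt simp: eventually_at_right_field intro!: exI[of _ 1])

lemma xi_hat_tendsto: "(xi_hat \<longlongrightarrow> sqrt 3 / 2) (at_right 0)"
proof -
  have "((\<lambda>c. (3 - 8 * c / (1 - c\<^sup>2)) / 4) \<longlongrightarrow> ((3::real) - 8 * 0 / (1 - 0\<^sup>2)) / 4) (at_right 0)"
    by (intro tendsto_intros) auto
  then have lower: "((\<lambda>c. (3 - 8 * c / (1 - c\<^sup>2)) / 4) \<longlongrightarrow> (3 / 4 :: real)) (at_right 0)" by simp
  have "((\<lambda>c. (xi_hat c)\<^sup>2) \<longlongrightarrow> 3 / 4) (at_right 0)"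
  proof (rule tendsto_sandwich[OF _ _ lower tendsto_const])
    show "\<forall>\<^sub>F c in at_right 0. (3 - 8 * c / (1 - c\<^sup>2)) / 4 \<le> (xi_hat c)\<^sup>2"
      using eventually_arc
    proof eventually_elim
      case (elim c) from arc.defect_le[OF this] show ?case by (simp only: le_diff_eq diff_le_eq) simp
    qed
    show "\<forall>\<^sub>F c in at_right 0. (xi_hat c)\<^sup>2 \<le> 3 / 4"
      using eventually_arc by eventually_elim (auto dest: arc.xi_hat_sq_less)
  qed
  then have "((\<lambda>c. sqrt ((xi_hat c)\<^sup>2)) \<longlongrightarrow> sqrt (3 / 4)) (at_right 0)"
    by (rule tendsto_real_sqrt)
  then have "((\<lambda>c. sqrt ((xi_hat c)\<^sup>2)) \<longlongrightarrow> sqrt 3 / 2) (at_right 0)"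
    by (simp add: real_sqrt_divide)
  then show ?thesis
  proof (rule Lim_transform_eventually)
    show "\<forall>\<^sub>F c in at_right 0. sqrt ((xi_hat c)\<^sup>2) = xi_hat c"
      using eventually_arc by eventually_elim (auto dest: arc.xi_hat_pos)
  qed
qed

lemma middle_abscissa_tendsto:
  "((\<lambda>c. (3 - 4 * (xi_hat c)\<^sup>2) / (3 * c)) \<longlongrightarrow> 8 * sqrt 3 / 9) (at_right 0)"
proof -
  \<comment> \<open>By \<open>defect_eq\<close> this is the middle abscissa without its 0/0 form,
    continuous at \<open>c = 0\<close>, \<open>x = sqrt 3 / 2\<close>.\<close>
  let ?f = "\<lambda>c x. (4 * x\<^sup>2 - sqrt (1 - c\<^sup>2) * c * x + (sqrt (1 - c\<^sup>2))\<^sup>2) / (sqrt (1 - c\<^sup>2) * x) / 3"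
  have "((\<lambda>c. ?f c (xi_hat c)) \<longlongrightarrow> ?f 0 (sqrt 3 / 2)) (at_right 0)"
    by (intro tendsto_intros xi_hat_tendsto) auto
  moreover have "?f 0 (sqrt 3 / 2) = 8 * sqrt 3 / 9"
    by (simp add: power_divide field_simps)
  ultimately have "((\<lambda>c. ?f c (xi_hat c)) \<longlongrightarrow> 8 * sqrt 3 / 9) (at_right 0)" by (simp only:)
  then show ?thesis
  proof (rule Lim_transform_eventually)
    show "\<forall>\<^sub>F c in at_right 0. ?f c (xi_hat c) = (3 - 4 * (xi_hat c)\<^sup>2) / (3 * c)"
      using eventually_arc
    proof eventually_elim
      case (elim c)
      have "0 < c" using elim by (rule arc.c_pos)
      then show ?case unfolding arc.defect_eq[OF elim] by simp
    qed
  qed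
qed

theorem mainTheorem6:
  shows "(\<forall>\<phi>. 0 < \<phi> \<and> \<phi> < pi / 2 \<longrightarrow>
            (\<exists>!\<xi>. \<xi> \<in> {delta2 (cos \<phi>)..} \<and> td (cos \<phi>) \<xi> = 0) \<and>
            (\<forall>\<xi>. optimal_outer (cos \<phi>) (sin \<phi>) \<xi> \<longleftrightarrow> \<xi> = xi_hat (cos \<phi>))) \<and>
         (xi_hat \<longlongrightarrow> sqrt 3 / 2) (at_right 0) \<and>
         ((\<lambda>c. (3 - 4 * (xi_hat c)\<^sup>2) / (3 * c)) \<longlongrightarrow> 8 * sqrt 3 / 9) (at_right 0)"
proof (intro conjI xi_hat_tendsto middle_abscissa_tendsto allI impI)
  fix \<phi> :: real assume \<phi>: "0 < \<phi> \<and> \<phi> < pi / 2"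
  interpret arc "cos \<phi>" "sin \<phi>"
    using \<phi> by unfold_locales (auto simp: cos_gt_zero sin_gt_zero sin_squared_eq)
  show "\<exists>!\<xi>. \<xi> \<in> {delta2 (cos \<phi>)..} \<and> td (cos \<phi>) \<xi> = 0" by (rule ex1_zero)
  show "optimal_outer (cos \<phi>) (sin \<phi>) \<xi> \<longleftrightarrow> \<xi> = xi_hat (cos \<phi>)" for \<xi>
    by (rule optimal_outer_iff)
qed

end
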